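(* Let $B$ be a non-abelian group and let $H$ be a finitely generated infinite group. Then the unrestricted wreath product $B\wr H$ contains a condensed subgroup.
   Context: For groups $B,H$, $B^H$ denotes the group of all functions $H\to B$ under pointwise multiplication, and the unrestricted wreath product $B\wr H$ is the semidirect product $B^H\rtimes H$ where $H$ acts by $(hfh^{-1})(x)=f(h^{-1}x)$ for $h,x\in H$, $f\in B^H$. Space of marked groups: for $n\in\mathbb N$, $\mathcal G_n$ is the set of pairs $(G,A)$, $G$ a group and $A=(a_1,\dots,a_n)$ an ordered generating tuple, modulo $(G,(a_i))\approx(H,(b_i))$ iff $a_i\mapsto b_i$ extends to an isomorphism $G\to H$. Write $(G,A)\approx_r(H,B)$ if there is an isomorphism of labeled directed graphs between the balls of radius $r$ about the identity in the Cayley graphs of $(G,A)$ and $(H,B)$ sending edges labeled $a_i$ to edges labeled $b_i$. The topology on $\mathcal G_n$ has basis the sets $\{(H,B)\in\mathcal G_n:(H,B)\approx_r(G,A)\}$, $r\in\mathbb N$. Identifying $(G,(a_1,\dots,a_n))$ with $(G,(a_1,\dots,a_n,1))$ embeds $\mathcal G_n\subseteq\mathcal G_{n+1}$, and $\mathcal G=\bigcup_n\mathcal G_n$ with the union topology is the space of finitely generated marked groups. For a finitely generated group $G$, $[G]=\{(H,B)\in\mathcal G: H\cong G\}$. A finitely generated group $G$ is condensed if $[G]$ has no isolated points in $\mathcal G$. *)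

theory Defs
  imports "HOL-Algebra.Algebra"
begin

text \<open>Elements are pairs (f, h) with f : H -> B (extensional on the carrier of H),
  standing for f h.  (f h)(f' h') = f (h f' h^-1) h h' where
  (h f' h^-1)(x) = f'(h^-1 x).\<close>

definition wreath :: "'b monoid \<Rightarrow> 'h monoid \<Rightarrow> (('h \<Rightarrow> 'b) \<times> 'h) monoid" where
  "wreath B H = \<lparr> carrier = (carrier H \<rightarrow>\<^sub>E carrier B) \<times> carrier H,
     monoid.mult = (\<lambda>(f, h) (f', h'). ((\<lambda>x\<in>carrier H. f x \<otimes>\<^bsub>B\<^esub> f' (inv\<^bsub>H\<^esub> h \<otimes>\<^bsub>H\<^esub> x)),
                                 h \<otimes>\<^bsub>H\<^esub> h')),
     one = ((\<lambda>x\<in>carrier H. \<one>\<^bsub>B\<^esub>), \<one>\<^bsub>H\<^esub>) \<rparr>"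

definition fin_gen :: "('a, 'c) monoid_scheme \<Rightarrow> bool" where
  "fin_gen G \<longleftrightarrow> (\<exists>S. finite S \<and> S \<subseteq> carrier G \<and> generate G S = carrier G)"

text \<open>A generating tuple (a_1,...,a_n) is represented by a sequence a :: nat => _
  with a i = 1 for i >= n (this realises the identification of G_n inside G_(n+1)
  by padding with 1).  Representatives of points of the space are taken with
  carrier a set of naturals (every finitely generated group is countable).\<close>

definition marked :: "nat monoid \<times> (nat \<Rightarrow> nat) \<Rightarrow> bool" where
  "marked x \<longleftrightarrow> group (fst x) \<and> range (snd x) \<subseteq> carrier (fst x)
      \<and> generate (fst x) (range (snd x)) = carrier (fst x)"

definition in_Gn :: "nat \<Rightarrow> nat monoid \<times> (nat \<Rightarrow> nat) \<Rightarrow> bool" where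
  "in_Gn n x \<longleftrightarrow> marked x \<and> (\<forall>i\<ge>n. snd x i = \<one>\<^bsub>fst x\<^esub>)"

definition in_G :: "nat monoid \<times> (nat \<Rightarrow> nat) \<Rightarrow> bool" where
  "in_G x \<longleftrightarrow> (\<exists>n. in_Gn n x)"

definition marked_equiv :: "nat monoid \<times> (nat \<Rightarrow> nat) \<Rightarrow> nat monoid \<times> (nat \<Rightarrow> nat) \<Rightarrow> bool" where
  "marked_equiv x y \<longleftrightarrow> (\<exists>\<phi>\<in>iso (fst x) (fst y). \<forall>i. \<phi> (snd x i) = snd y i)"

fun cball :: "('a, 'c) monoid_scheme \<Rightarrow> (nat \<Rightarrow> 'a) \<Rightarrow> nat \<Rightarrow> 'a set" where
  "cball G a 0 = {\<one>\<^bsub>G\<^esub>}"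
| "cball G a (Suc r) = cball G a r \<union>
     {g \<otimes>\<^bsub>G\<^esub> s | g s. g \<in> cball G a r \<and> (s \<in> range a \<or> s \<in> (\<lambda>t. inv\<^bsub>G\<^esub> t) ` range a)}"

text \<open>Isomorphism of labelled directed graphs between the balls of radius r
  (edges u --i--> u a_i), sending the identity to the identity.\<close>
definition ball_equiv :: "nat \<Rightarrow> nat monoid \<times> (nat \<Rightarrow> nat) \<Rightarrow> nat monoid \<times> (nat \<Rightarrow> nat) \<Rightarrow> bool" where
  "ball_equiv r x y \<longleftrightarrow> (\<exists>f. bij_betw f (cball (fst x) (snd x) r) (cball (fst y) (snd y) r)
      \<and> f \<one>\<^bsub>fst x\<^esub> = \<one>\<^bsub>fst y\<^esub>
      \<and> (\<forall>u\<in>cball (fst x) (snd x) r. \<forall>v\<in>cball (fst x) (snd x) r. \<forall>i.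
            v = u \<otimes>\<^bsub>fst x\<^esub> snd x i \<longleftrightarrow> f v = f u \<otimes>\<^bsub>fst y\<^esub> snd y i))"

text \<open>Open sets of the union topology on G, represented as sets of representatives
  saturated under marked_equiv: U is open iff U intersected with each G_n is open in
  G_n, whose topology has basis {y in G_n. y ~_r x}, x in G_n, r in N.\<close>
definition mg_open :: "(nat monoid \<times> (nat \<Rightarrow> nat)) set \<Rightarrow> bool" where
  "mg_open U \<longleftrightarrow> U \<subseteq> Collect in_G
     \<and> (\<forall>x\<in>U. \<forall>y. in_G y \<and> marked_equiv x y \<longrightarrow> y \<in> U)
     \<and> (\<forall>n. \<forall>z\<in>U. in_Gn n z \<longrightarrow>
          (\<exists>x r. in_Gn n x \<and> ball_equiv r z x \<and>
                 (\<forall>y. in_Gn n y \<and> ball_equiv r y x \<longrightarrow> y \<in> U)))"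

definition condensed :: "('a, 'c) monoid_scheme \<Rightarrow> bool" where
  "condensed G \<longleftrightarrow> (\<forall>x. in_G x \<and> fst x \<cong> G \<longrightarrow>
      (\<forall>U. mg_open U \<and> x \<in> U \<longrightarrow> (\<exists>y\<in>U. fst y \<cong> G \<and> \<not> marked_equiv x y)))"

end

theory Submission
  imports Defs
begin

text \<open>Let a, b be non-commuting elements of B. In the wreath product take the subgroup G generated by H,
  by the functions supported at 1 with values a and b, and by the function g equal to b on a subset D
  of H and trivial elsewhere. Removing a point y from D multiplies g by a finitely supported function of G,
  so G does not change, but its marking does: y belongs to D iff g fails to commute with the
  function supported at y with value a. If D is infinite and sparse (its far away points are far from all other
  points of D) and y is far away, a short word cannot see the difference: near 1 both sets look the same,
  and away from 1 a short word evaluates to a function of the local pattern of D, where the only patterns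
  involved are the empty one, with value 1, and one-point patterns, which occur at other
  points of D as well. Finally, the existence of such perturbations at all scales does not depend on the
  generating tuple.\<close>

section \<open>Balls in Cayley graphs\<close>

lemma cball_mono: "r \<le> t \<Longrightarrow> cball G a r \<subseteq> cball G a t"
  by (rule lift_Suc_mono_le) auto

lemma cball_SucI:
  assumes "g \<in> cball G a r" "s \<in> range a \<or> s \<in> (\<lambda>t. inv\<^bsub>G\<^esub> t) ` range a"
  shows "g \<otimes>\<^bsub>G\<^esub> s \<in> cball G a (Suc r)"
  using assms unfolding cball.simps by blast

lemma one_in_cball: "\<one>\<^bsub>G\<^esub> \<in> cball G a r"
  by (induction r) auto

lemma cball_carrier:
  assumes "group G" "range a \<subseteq> carrier G"
  shows "cball G a r \<subseteq> carrier G"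
proof -
  interpret group G by fact
  show ?thesis using assms(2) by (induction r) (auto intro!: m_closed inv_closed)
qed

lemma finite_cball: "finite (range a) \<Longrightarrow> finite (cball G a r)"
proof (induction r)
  case (Suc r)
  have "cball G a (Suc r) = cball G a r \<union>
     (\<lambda>(g, s). g \<otimes>\<^bsub>G\<^esub> s) ` (cball G a r \<times> (range a \<union> (\<lambda>t. inv\<^bsub>G\<^esub> t) ` range a))"
    unfolding cball.simps by fast
  with Suc show ?case by (metis finite_Un finite_SigmaI finite_imageI)
qed simp

lemma gen_in_cball:
  assumes "group G" "range a \<subseteq> carrier G"
  shows "a i \<in> cball G a (Suc r)" "inv\<^bsub>G\<^esub> a i \<in> cball G a (Suc r)"
proof -
  interpret group G by fact
  have c: "a i \<in> carrier G" using assms(2) by auto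
  show "a i \<in> cball G a (Suc r)"
    using cball_SucI[OF one_in_cball, of "a i" a G r] c by auto
  show "inv\<^bsub>G\<^esub> a i \<in> cball G a (Suc r)"
    using cball_SucI[OF one_in_cball, of "inv\<^bsub>G\<^esub> a i" a G r] c by auto
qed

lemma cball_mult:
  assumes "group G" "range a \<subseteq> carrier G" "u \<in> cball G a r" "v \<in> cball G a t"
  shows "u \<otimes>\<^bsub>G\<^esub> v \<in> cball G a (r + t)"
proof -
  interpret group G by fact
  note carr = cball_carrier[OF assms(1,2)]
  have u: "u \<in> carrier G" using assms(3) carr by blast
  show ?thesis using assms(4)
  proof (induction t arbitrary: v)
    case 0
    then show ?case using assms(3) u by simp
  next
    case (Suc t)
    then consider "v \<in> cball G a t"
      | g s where "v = g \<otimes>\<^bsub>G\<^esub> s" "g \<in> cball G a t" "s \<in> range a \<or> s \<in> (\<lambda>t. inv\<^bsub>G\<^esub> t) ` range a"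
      by auto
    then show ?case
    proof cases
      case 1
      then show ?thesis using Suc.IH cball_mono[of "r + t" "r + Suc t" G a] by auto
    next
      case 2
      have "g \<in> carrier G" "s \<in> carrier G" using 2 carr assms(2) by auto
      then have "u \<otimes>\<^bsub>G\<^esub> v = (u \<otimes>\<^bsub>G\<^esub> g) \<otimes>\<^bsub>G\<^esub> s" using 2 u by (simp add: m_assoc)
      then show ?thesis using cball_SucI[OF Suc.IH[OF 2(2)] 2(3)] by simp
    qed
  qed
qed

lemma cball_inv:
  assumes "group G" "range a \<subseteq> carrier G" "u \<in> cball G a r"
  shows "inv\<^bsub>G\<^esub> u \<in> cball G a r"
proof -
  interpret group G by fact
  note carr = cball_carrier[OF assms(1,2)]
  show ?thesis using assms(3)
  proof (induction r arbitrary: u)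
    case 0
    then show ?case by simp
  next
    case (Suc r)
    then consider "u \<in> cball G a r"
      | g s where "u = g \<otimes>\<^bsub>G\<^esub> s" "g \<in> cball G a r" "s \<in> range a \<or> s \<in> (\<lambda>t. inv\<^bsub>G\<^esub> t) ` range a"
      by auto
    then show ?case
    proof cases
      case 1
      then show ?thesis using Suc.IH by auto
    next
      case 2
      have c: "g \<in> carrier G" "s \<in> carrier G" using 2 carr assms(2) by auto
      have "inv\<^bsub>G\<^esub> s \<in> cball G a (Suc 0)"
        using 2(3) gen_in_cball[OF assms(1,2), of _ 0] assms(2) by (auto simp del: cball.simps simp: image_subset_iff)
      from cball_mult[OF assms(1,2) this Suc.IH[OF 2(2)]]
      show ?thesis using 2 c by (simp add: inv_mult_group)
    qed
  qed
qed

lemma cball_subset_generate: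
  assumes "group G" "range a \<subseteq> carrier G"
  shows "cball G a r \<subseteq> generate G (range a)"
proof (induction r)
  case 0
  then show ?case by (simp add: generate.one)
next
  case (Suc r)
  have "s \<in> generate G (range a)" if "s \<in> range a \<or> s \<in> (\<lambda>t. inv\<^bsub>G\<^esub> t) ` range a" for s
    using that by (auto intro: generate.incl generate.inv)
  with Suc show ?case by (auto intro!: generate.eng)
qed

lemma generate_imp_cball:
  assumes "group G" "range a \<subseteq> carrier G" "u \<in> generate G (range a)"
  shows "\<exists>r. u \<in> cball G a r"
  using assms(3)
proof (induction rule: generate.induct)
  case one
  then show ?case using one_in_cball by blast
next
  case (incl h)
  then show ?case using gen_in_cball(1)[OF assms(1,2)] by blast
next
  case (inv h)
  then show ?case using gen_in_cball(2)[OF assms(1,2)] by blast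
next
  case (eng h1 h2)
  then show ?case using cball_mult[OF assms(1,2)] by blast
qed

lemma finite_subset_cball:
  assumes "group G" "range a \<subseteq> carrier G" "finite F" "F \<subseteq> generate G (range a)"
  shows "\<exists>r. F \<subseteq> cball G a r"
  using assms(3,4)
proof (induction F rule: finite_induct)
  case (insert x F)
  then obtain r t where "F \<subseteq> cball G a r" "x \<in> cball G a t"
    using generate_imp_cball[OF assms(1,2), of x] by auto
  then have "insert x F \<subseteq> cball G a (max r t)"
    using cball_mono[of r "max r t" G a] cball_mono[of t "max r t" G a] by auto
  then show ?case by blast
qed simp

text \<open>Letters of \<open>d\<close> and their inverses are words of length at most
  \<open>m\<close> in \<open>a\<close>, so word lengths grow at most by the factor \<open>m\<close>.
  Applied in direct squares, this compares pairs of tuples.\<close>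

lemma cball_refine:
  assumes "group G" "range a \<subseteq> carrier G" "range d \<subseteq> cball G a m"
  shows "cball G d r \<subseteq> cball G a (m * r)"
proof (induction r)
  case 0
  then show ?case by simp
next
  case (Suc r)
  have "s \<in> cball G a m" if "s \<in> range d \<or> s \<in> (\<lambda>t. inv\<^bsub>G\<^esub> t) ` range d" for s
    using that assms(3) cball_inv[OF assms(1,2)] by auto
  then have "g \<otimes>\<^bsub>G\<^esub> s \<in> cball G a (m * Suc r)"
    if "g \<in> cball G d r" "s \<in> range d \<or> s \<in> (\<lambda>t. inv\<^bsub>G\<^esub> t) ` range d" for g s
    using cball_mult[OF assms(1,2), of g "m * r" s m] that Suc by (auto simp: add.commute)
  moreover have "cball G d r \<subseteq> cball G a (m * Suc r)"
    using Suc cball_mono[of "m * r" "m * Suc r" G a] by auto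
  ultimately show ?case by auto
qed

text \<open>Evaluating words commutes with homomorphisms. Later uses are the projections of a direct
  square, a diagonal map and the graph of an automorphism.\<close>

lemma cball_hom:
  assumes "group G" "group K" "\<chi> \<in> hom G K" "range a \<subseteq> carrier G"
  shows "cball K (\<lambda>i. \<chi> (a i)) r = \<chi> ` cball G a r"
proof (induction r)
  case 0
  then show ?case using hom_one[OF assms(3,1,2)] by simp
next
  case (Suc r)
  interpret group_hom G K \<chi> using assms by (simp add: group_hom_def group_hom_axioms_def)
  note carr = cball_carrier[OF assms(1,4)]
  have gens: "range (\<lambda>i. \<chi> (a i)) \<union> (\<lambda>t. inv\<^bsub>K\<^esub> t) ` range (\<lambda>i. \<chi> (a i))
      = \<chi> ` (range a \<union> (\<lambda>t. inv\<^bsub>G\<^esub> t) ` range a)"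
    using assms(4) by (simp add: image_Un image_image image_subset_iff)
  have ball: "cball L d (Suc r) = cball L d r \<union>
     (\<Union>g\<in>cball L d r. (\<lambda>s. g \<otimes>\<^bsub>L\<^esub> s) ` (range d \<union> (\<lambda>t. inv\<^bsub>L\<^esub> t) ` range d))"
    for L :: "('x, 'y) monoid_scheme" and d
    unfolding cball.simps by fast
  have "(\<lambda>s. \<chi> g \<otimes>\<^bsub>K\<^esub> s) ` \<chi> ` (range a \<union> (\<lambda>t. inv\<^bsub>G\<^esub> t) ` range a)
     = \<chi> ` (\<lambda>s. g \<otimes>\<^bsub>G\<^esub> s) ` (range a \<union> (\<lambda>t. inv\<^bsub>G\<^esub> t) ` range a)" if "g \<in> cball G a r" for g
    unfolding image_image
    by (rule image_cong[OF refl]) (use that carr[of r] assms(4) in \<open>auto simp: subset_iff\<close>)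
  then show ?case
    unfolding ball Suc.IH gens by (simp add: image_Un image_UN)
qed

section \<open>Deformable generating tuples\<close>

text \<open>The pairs of values taken by words of length at most r on the tuples a and b.\<close>

definition pair_ball where
  "pair_ball G a b r = cball (G \<times>\<times> G) (\<lambda>i. (a i, b i)) r"

text \<open>The entries of a pair are values of one word at the two tuples, so this says that
  \<open>a\<close> and \<open>b\<close> satisfy the same relations of length at most
  \<open>r\<close>.\<close>

definition agree_upto where
  "agree_upto G r a b \<longleftrightarrow> (\<forall>(u, v)\<in>pair_ball G a b r. u = \<one>\<^bsub>G\<^esub> \<longleftrightarrow> v = \<one>\<^bsub>G\<^esub>)"

text \<open>Arbitrarily close to the marking \<open>a\<close> lies another marking of the same
  group. The last clause makes it inequivalent, since an automorphism taking \<open>a\<close> to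
  \<open>b\<close> would preserve relations of every length.\<close>

definition deformable :: "('a, 'c) monoid_scheme \<Rightarrow> (nat \<Rightarrow> 'a) \<Rightarrow> bool" where
  "deformable G a \<longleftrightarrow> (\<forall>r. \<exists>b. range b \<subseteq> carrier G \<and> generate G (range b) = carrier G
     \<and> agree_upto G r a b
     \<and> (\<exists>k. \<not> agree_upto G k a b))"

section \<open>Values of the same word at two tuples\<close>

context
  fixes G :: "('a, 'c) monoid_scheme" and a b :: "nat \<Rightarrow> 'a"
  assumes grp: "group G" and a: "range a \<subseteq> carrier G" and b: "range b \<subseteq> carrier G"
begin

lemma pair_range: "range (\<lambda>i. (a i, b i)) \<subseteq> carrier (G \<times>\<times> G)"
  using a b by auto

lemma pair_ball_carrier: "(u, v) \<in> pair_ball G a b r \<Longrightarrow> u \<in> carrier G \<and> v \<in> carrier G"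
  unfolding pair_ball_def using cball_carrier[OF DirProd_group[OF grp grp] pair_range] by auto

lemma pair_ball_mono: "r \<le> t \<Longrightarrow> p \<in> pair_ball G a b r \<Longrightarrow> p \<in> pair_ball G a b t"
  unfolding pair_ball_def by (rule subsetD[OF cball_mono])

lemma pair_ball_mult:
  "(u, v) \<in> pair_ball G a b r \<Longrightarrow> (u', v') \<in> pair_ball G a b t
    \<Longrightarrow> (u \<otimes>\<^bsub>G\<^esub> u', v \<otimes>\<^bsub>G\<^esub> v') \<in> pair_ball G a b (r + t)"
  unfolding pair_ball_def using cball_mult[OF DirProd_group[OF grp grp] pair_range, of "(u, v)" r "(u', v')" t] by simp

lemma pair_ball_inv:
  assumes "(u, v) \<in> pair_ball G a b r"
  shows "(inv\<^bsub>G\<^esub> u, inv\<^bsub>G\<^esub> v) \<in> pair_ball G a b r"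
  using cball_inv[OF DirProd_group[OF grp grp] pair_range assms[unfolded pair_ball_def]]
    pair_ball_carrier[OF assms] inv_DirProd[OF grp grp] by (simp add: pair_ball_def)

lemma pair_ball_gen: "(a i, b i) \<in> pair_ball G a b (Suc r)"
  unfolding pair_ball_def using gen_in_cball(1)[OF DirProd_group[OF grp grp] pair_range] .

lemma pair_ball_fst: "fst ` pair_ball G a b r = cball G a r"
  using cball_hom[OF DirProd_group[OF grp grp] grp _ pair_range, of fst r]
  by (simp add: pair_ball_def hom_def Pi_iff)

lemma pair_ball_snd: "snd ` pair_ball G a b r = cball G b r"
  using cball_hom[OF DirProd_group[OF grp grp] grp _ pair_range, of snd r]
  by (simp add: pair_ball_def hom_def Pi_iff)

text \<open>Equality of two words is triviality of their quotient, a word of length at most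
  \<open>r + t\<close>.\<close>

lemma pair_ball_eq_iff:
  assumes "agree_upto G R a b"
    and "(u, v) \<in> pair_ball G a b r" "(u', v') \<in> pair_ball G a b t" "r + t \<le> R"
  shows "u = u' \<longleftrightarrow> v = v'"
proof -
  interpret group G by (rule grp)
  have "(inv\<^bsub>G\<^esub> u \<otimes>\<^bsub>G\<^esub> u', inv\<^bsub>G\<^esub> v \<otimes>\<^bsub>G\<^esub> v') \<in> pair_ball G a b R"
    using pair_ball_mono[OF assms(4)] pair_ball_mult[OF pair_ball_inv[OF assms(2)] assms(3)] by blast
  then have "inv\<^bsub>G\<^esub> u \<otimes>\<^bsub>G\<^esub> u' = \<one>\<^bsub>G\<^esub> \<longleftrightarrow> inv\<^bsub>G\<^esub> v \<otimes>\<^bsub>G\<^esub> v' = \<one>\<^bsub>G\<^esub>"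
    using assms(1) unfolding agree_upto_def by blast
  moreover have "inv\<^bsub>G\<^esub> x \<otimes>\<^bsub>G\<^esub> y = \<one>\<^bsub>G\<^esub> \<longleftrightarrow> x = y" if "x \<in> carrier G" "y \<in> carrier G" for x y
    using that by (metis inv_solve_left one_closed r_one)
  ultimately show ?thesis
    using pair_ball_carrier[OF assms(2)] pair_ball_carrier[OF assms(3)] by simp
qed

lemma pair_ball_refine:
  assumes "\<And>i. (c i, d i) \<in> pair_ball G a b m"
  shows "pair_ball G c d r \<subseteq> pair_ball G a b (m * r)"
  unfolding pair_ball_def
  by (rule cball_refine[OF DirProd_group[OF grp grp] pair_range])
    (use assms in \<open>auto simp: pair_ball_def\<close>)

end

text \<open>Each \<open>c i\<close> is a word in \<open>a\<close>; the same word evaluated at a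
  nearby tuple \<open>b\<close> gives \<open>d i\<close>. Finitely many values occur, so the word
  lengths are bounded and closeness of \<open>b\<close> to \<open>a\<close> becomes closeness of
  \<open>d\<close> to \<open>c\<close>.\<close>

lemma deformable_change_generators:
  assumes grp: "group G" and a: "range a \<subseteq> carrier G" and c: "range c \<subseteq> carrier G"
    and fin: "finite (range a)" "finite (range c)"
    and gen: "generate G (range a) = carrier G" "generate G (range c) = carrier G"
    and def: "deformable G a"
  shows "deformable G c"
  unfolding deformable_def
proof
  fix r
  interpret group G by (rule grp)
  obtain m where m: "range c \<subseteq> cball G a m"
    using finite_subset_cball[OF grp a fin(2)] c gen by auto
  obtain k where k: "range a \<subseteq> cball G c k"
    using finite_subset_cball[OF grp c fin(1)] a gen by auto
  \<comment> \<open>\<open>m * r\<close> covers words of length \<open>r\<close> in \<open>c\<close>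
    and \<open>d\<close>; \<open>m * k + 1\<close> allows a word of length \<open>m * k\<close> to
    be compared with a single letter.\<close>
  define R where "R = m * r + (m * k + 1)"
  obtain b where b: "range b \<subseteq> carrier G" "generate G (range b) = carrier G"
    and loc: "agree_upto G R a b"
    and glob: "\<exists>k. \<not> agree_upto G k a b"
    using def unfolding deformable_def by blast
  have "\<exists>v. (c i, v) \<in> pair_ball G a b m" for i
  proof -
    have "c i \<in> fst ` pair_ball G a b m" using m pair_ball_fst[OF grp a b(1)] by auto
    then show ?thesis by force
  qed
  then obtain d where d: "\<And>i. (c i, d i) \<in> pair_ball G a b m" by metis
  have dc: "range d \<subseteq> carrier G" using pair_ball_carrier[OF grp a b(1) d] by auto
  note refine = pair_ball_refine[OF grp a b(1), of c d, OF d]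
  \<comment> \<open>A word in \<open>c\<close> with value \<open>a i\<close> has some value
    \<open>e\<close> at \<open>d\<close>. Expanded into \<open>a\<close> and \<open>b\<close>, it
    equals the letter \<open>a i\<close> in the first entry, and agreement up to \<open>R\<close>
    forces \<open>e = b i\<close> in the second.\<close>
  have ab: "(a i, b i) \<in> pair_ball G c d k" for i
  proof -
    have "a i \<in> fst ` pair_ball G c d k" using k pair_ball_fst[OF grp c dc] by auto
    then obtain e where e: "(a i, e) \<in> pair_ball G c d k" by force
    then have "(a i, e) \<in> pair_ball G a b (m * k)" using refine by blast
    then have "b i = e"
      using pair_ball_eq_iff[OF grp a b(1) loc _ pair_ball_gen[OF grp a b(1)], of "a i" e "m * k" 0 i]
      by (simp add: R_def)
    then show ?thesis using e by simp
  qed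
  have "range b \<subseteq> generate G (range d)"
  proof -
    have "b i \<in> cball G d k" for i using ab[of i] pair_ball_snd[OF grp c dc] by force
    then show ?thesis using cball_subset_generate[OF grp dc] by blast
  qed
  then have "generate G (range d) = carrier G"
    using generate_subgroup_incl[OF _ generate_is_subgroup[OF dc]] generate_incl[OF dc] b(2) by blast
  moreover have "agree_upto G r c d"
  proof -
    have "pair_ball G c d r \<subseteq> pair_ball G a b R"
      using refine[of r] pair_ball_mono[OF grp a b(1), of "m * r" R] by (auto simp: R_def)
    then show ?thesis using loc unfolding agree_upto_def by blast
  qed
  \<comment> \<open>The letters of \<open>a\<close> and \<open>b\<close> are simultaneous words in
    \<open>c\<close> and \<open>d\<close>, so agreement of \<open>c\<close> and \<open>d\<close> at
    all lengths would pass back to \<open>a\<close> and \<open>b\<close>.\<close>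
  moreover have "\<exists>k. \<not> agree_upto G k c d"
    using glob pair_ball_refine[OF grp c dc, of a b, OF ab] unfolding agree_upto_def by blast
  ultimately show "\<exists>b. range b \<subseteq> carrier G \<and> generate G (range b) = carrier G
     \<and> agree_upto G r c b
     \<and> (\<exists>k. \<not> agree_upto G k c b)"
    using dc by blast
qed

lemma pair_ball_hom:
  assumes "group G" "group K" "\<chi> \<in> hom G K" "range a \<subseteq> carrier G" "range b \<subseteq> carrier G"
  shows "pair_ball K (\<lambda>i. \<chi> (a i)) (\<lambda>i. \<chi> (b i)) r = map_prod \<chi> \<chi> ` pair_ball G a b r"
proof -
  have "map_prod \<chi> \<chi> \<in> hom (G \<times>\<times> G) (K \<times>\<times> K)"
    using assms(3) by (auto simp: hom_def)
  from cball_hom[OF DirProd_group[OF assms(1,1)] DirProd_group[OF assms(2,2)] this pair_range[OF assms(1,4,5)]]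
  show ?thesis by (simp add: pair_ball_def)
qed

text \<open>Used to pass to a copy of the group on natural numbers. Injectivity of
  \<open>\<chi>\<close> ensures that a word is trivial exactly when its image is.\<close>

lemma deformable_iso:
  assumes G: "group G" and K: "group K" and iso: "\<chi> \<in> iso G K" and a: "range a \<subseteq> carrier G"
    and def: "deformable G a"
  shows "deformable K (\<lambda>i. \<chi> (a i))"
  unfolding deformable_def
proof
  fix r
  have hom: "\<chi> \<in> hom G K" and bij: "bij_betw \<chi> (carrier G) (carrier K)"
    using iso by (auto simp: iso_def)
  interpret group_hom G K \<chi> using G K hom by (simp add: group_hom_def group_hom_axioms_def)
  have one: "\<chi> u = \<one>\<^bsub>K\<^esub> \<longleftrightarrow> u = \<one>\<^bsub>G\<^esub>" if "u \<in> carrier G" for u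
    using that bij hom_one by (metis G.one_closed bij_betw_def inj_onD)
  obtain b where b: "range b \<subseteq> carrier G" "generate G (range b) = carrier G"
    and loc: "agree_upto G r a b"
    and glob: "\<exists>k. \<not> agree_upto G k a b"
    using def unfolding deformable_def by blast
  have trans: "(\<chi> u = \<one>\<^bsub>K\<^esub> \<longleftrightarrow> \<chi> v = \<one>\<^bsub>K\<^esub>) \<longleftrightarrow> (u = \<one>\<^bsub>G\<^esub> \<longleftrightarrow> v = \<one>\<^bsub>G\<^esub>)"
    if "(u, v) \<in> pair_ball G a b k" for u v k
    using one pair_ball_carrier[OF G a b(1) that] by simp
  have "range (\<lambda>i. \<chi> (b i)) \<subseteq> carrier K" using b(1) by auto
  moreover have "generate K (range (\<lambda>i. \<chi> (b i))) = carrier K"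
    using generate_img[OF b(1)] b(2) bij by (simp add: bij_betw_def image_image)
  moreover have "agree_upto K r (\<lambda>i. \<chi> (a i)) (\<lambda>i. \<chi> (b i))"
    using loc trans unfolding agree_upto_def pair_ball_hom[OF G K hom a b(1)] by fastforce
  moreover have "\<exists>k. \<not> agree_upto K k (\<lambda>i. \<chi> (a i)) (\<lambda>i. \<chi> (b i))"
    using glob trans unfolding agree_upto_def pair_ball_hom[OF G K hom a b(1)] by fastforce
  ultimately show "\<exists>b. range b \<subseteq> carrier K \<and> generate K (range b) = carrier K
     \<and> agree_upto K r (\<lambda>i. \<chi> (a i)) b
     \<and> (\<exists>k. \<not> agree_upto K k (\<lambda>i. \<chi> (a i)) b)"
    by blast
qed

section \<open>From deformable tuples to condensed groups\<close>

lemma ball_equiv_trans: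
  assumes xy: "ball_equiv r x y" and yz: "ball_equiv r y z"
  shows "ball_equiv r x z"
proof -
  obtain f where f: "bij_betw f (cball (fst x) (snd x) r) (cball (fst y) (snd y) r)"
    "f \<one>\<^bsub>fst x\<^esub> = \<one>\<^bsub>fst y\<^esub>"
    "\<And>u v i. u \<in> cball (fst x) (snd x) r \<Longrightarrow> v \<in> cball (fst x) (snd x) r \<Longrightarrow>
       v = u \<otimes>\<^bsub>fst x\<^esub> snd x i \<longleftrightarrow> f v = f u \<otimes>\<^bsub>fst y\<^esub> snd y i"
    using xy unfolding ball_equiv_def by auto
  obtain g where g: "bij_betw g (cball (fst y) (snd y) r) (cball (fst z) (snd z) r)"
    "g \<one>\<^bsub>fst y\<^esub> = \<one>\<^bsub>fst z\<^esub>"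
    "\<And>u v i. u \<in> cball (fst y) (snd y) r \<Longrightarrow> v \<in> cball (fst y) (snd y) r \<Longrightarrow>
       v = u \<otimes>\<^bsub>fst y\<^esub> snd y i \<longleftrightarrow> g v = g u \<otimes>\<^bsub>fst z\<^esub> snd z i"
    using yz unfolding ball_equiv_def by auto
  have "f u \<in> cball (fst y) (snd y) r" if "u \<in> cball (fst x) (snd x) r" for u
    using f(1) that by (rule bij_betwE[rule_format])
  then show ?thesis
    unfolding ball_equiv_def
    by (intro exI[of _ "g \<circ> f"]) (simp add: bij_betw_trans[OF f(1) g(1)] f(2,3) g(2,3))
qed

text \<open>The isomorphism of balls sends the value of a word at \<open>b\<close> to its value at
  \<open>a\<close>. An edge equates words of lengths \<open>r\<close> and \<open>r + 1\<close>,
  whence the length \<open>2 * r + 1\<close>.\<close>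

lemma ball_equiv_if_pair_ball:
  assumes grp: "group M" and a: "range a \<subseteq> carrier M" and b: "range b \<subseteq> carrier M"
    and loc: "agree_upto M (2 * r + 1) a b"
  shows "ball_equiv r (M, b) (M, a)"
proof -
  note eq = pair_ball_eq_iff[OF grp a b loc]
  \<comment> \<open>Agreement makes all possible choices of \<open>u\<close> equal, which is
    \<open>f_eq\<close> below.\<close>
  define f where "f v = (SOME u. (u, v) \<in> pair_ball M a b r)" for v
  have f: "(f v, v) \<in> pair_ball M a b r" if "v \<in> cball M b r" for v
  proof -
    have "v \<in> snd ` pair_ball M a b r" using that pair_ball_snd[OF grp a b] by simp
    then have "\<exists>u. (u, v) \<in> pair_ball M a b r" by force
    then show ?thesis unfolding f_def by (rule someI_ex)
  qed
  have f_eq: "f v = u" if "(u, v) \<in> pair_ball M a b r" for u v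
  proof -
    have "v \<in> cball M b r" using that pair_ball_snd[OF grp a b] by force
    from eq[OF f[OF this] that] show ?thesis by simp
  qed
  have "inj_on f (cball M b r)"
    using eq[OF f f] by (intro inj_onI) auto
  moreover have "f ` cball M b r = cball M a r"
    using f f_eq by (force simp: pair_ball_fst[OF grp a b, symmetric] pair_ball_snd[OF grp a b, symmetric])
  ultimately have "bij_betw f (cball M b r) (cball M a r)" by (simp add: bij_betw_def)
  moreover have "f \<one>\<^bsub>M\<^esub> = \<one>\<^bsub>M\<^esub>"
    using one_in_cball[of "M \<times>\<times> M" "\<lambda>i. (a i, b i)" r] by (intro f_eq) (simp add: pair_ball_def)
  moreover have "v = u \<otimes>\<^bsub>M\<^esub> b i \<longleftrightarrow> f v = f u \<otimes>\<^bsub>M\<^esub> a i"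
    if "u \<in> cball M b r" "v \<in> cball M b r" for u v i
    using eq[OF f[OF that(2)] pair_ball_mult[OF grp a b f[OF that(1)] pair_ball_gen[OF grp a b, of i 0]]]
    by auto
  ultimately show ?thesis
    unfolding ball_equiv_def by auto
qed

text \<open>Deformability passes to every marking of every copy of \<open>G\<close>; the deformed
  tuple is then the second point required in a given neighbourhood.\<close>

lemma condensed_if_deformable:
  fixes G :: "('a, 'c) monoid_scheme"
  assumes G: "group G" and a: "range a \<subseteq> carrier G" and fin: "finite (range a)"
    and gen: "generate G (range a) = carrier G" and def: "deformable G a"
  shows "condensed G"
  unfolding condensed_def
proof (intro allI impI, elim conjE)
  fix x U
  assume inG: "in_G x" and "fst x \<cong> G" and U: "mg_open U" "x \<in> U"
  obtain M c where x: "x = (M, c)" by (cases x)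
  obtain n where n: "in_Gn n x" using inG by (auto simp: in_G_def)
  have M: "group M" and c: "range c \<subseteq> carrier M" and genc: "generate M (range c) = carrier M"
    and c1: "\<And>i. i \<ge> n \<Longrightarrow> c i = \<one>\<^bsub>M\<^esub>"
    using n x by (auto simp: in_Gn_def marked_def)
  have "range c \<subseteq> insert \<one>\<^bsub>M\<^esub> (c ` {..<n})" using c1 by (force simp: not_le)
  then have finc: "finite (range c)" by (rule finite_subset) simp
  have MG: "M \<cong> G" using \<open>fst x \<cong> G\<close> x by simp
  then obtain \<chi> where iso: "\<chi> \<in> iso G M" using group.iso_sym[OF M] by (auto simp: is_iso_def)
  then interpret group_hom G M \<chi> using G M by (simp add: group_hom_def group_hom_axioms_def iso_def)
  have "deformable M c"
  proof (rule deformable_change_generators[OF M _ c _ finc _ genc deformable_iso[OF G M iso a def]])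
    show "range (\<lambda>i. \<chi> (a i)) \<subseteq> carrier M" using a by auto
    show "finite (range (\<lambda>i. \<chi> (a i)))" using finite_imageI[OF fin, of \<chi>] by (simp add: image_image)
    show "generate M (range (\<lambda>i. \<chi> (a i))) = carrier M"
      using generate_img[OF a] gen iso by (simp add: iso_def bij_betw_def image_image)
  qed
  \<comment> \<open>The basic neighbourhood of \<open>x\<close> comes with a centre \<open>z\<close>
    that may differ from \<open>x\<close>, so closeness to \<open>z\<close> is obtained later by
    transitivity.\<close>
  moreover obtain z r where z: "ball_equiv r x z" "\<And>y. in_Gn n y \<Longrightarrow> ball_equiv r y z \<Longrightarrow> y \<in> U"
    using U n unfolding mg_open_def by blast
  ultimately obtain d where d: "range d \<subseteq> carrier M" "generate M (range d) = carrier M"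
    and loc: "agree_upto M (2 * r + 1) c d"
    and glob: "\<exists>k. \<not> agree_upto M k c d"
    unfolding deformable_def by blast
  \<comment> \<open>A letter is a word of length 1, so \<open>d\<close> is trivial wherever
    \<open>c\<close> is, and the new point has the same padding.\<close>
  have "d i = \<one>\<^bsub>M\<^esub>" if "i \<ge> n" for i
    using loc[unfolded agree_upto_def] pair_ball_gen[OF M c d(1), of i "2 * r"] c1[OF that] by auto
  then have "in_Gn n (M, d)" using M d by (simp add: in_Gn_def marked_def)
  moreover have "ball_equiv r (M, d) z"
    using ball_equiv_trans[OF ball_equiv_if_pair_ball[OF M c d(1) loc]] z(1) x by blast
  ultimately have "(M, d) \<in> U" using z(2) by blast
  moreover have "\<not> marked_equiv x (M, d)"
  proof
    assume "marked_equiv x (M, d)"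
    then obtain \<phi> where \<phi>: "\<phi> \<in> iso M M" "\<And>i. \<phi> (c i) = d i" using x by (auto simp: marked_equiv_def)
    \<comment> \<open>If \<open>\<phi>\<close> takes \<open>c\<close> to \<open>d\<close>, all pairs
      of values lie on the graph of \<open>\<phi>\<close>, and injectivity gives agreement at every
      length.\<close>
    have "(\<lambda>g. (g, \<phi> g)) \<in> hom M (M \<times>\<times> M)" using \<phi>(1) by (auto simp: iso_def hom_def)
    from cball_hom[OF M DirProd_group[OF M M] this c]
    have "pair_ball M c d k = (\<lambda>g. (g, \<phi> g)) ` cball M c k" for k
      by (simp add: pair_ball_def \<phi>(2))
    moreover have "\<phi> u = \<one>\<^bsub>M\<^esub> \<longleftrightarrow> u = \<one>\<^bsub>M\<^esub>" if "u \<in> carrier M" for u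
      using that Group.hom_one[of \<phi> M M, OF _ M M] group.is_monoid[OF M] \<phi>(1)
      by (auto simp: iso_def bij_betw_def dest: inj_onD[where y = "\<one>\<^bsub>M\<^esub>"] intro: monoid.one_closed)
    ultimately have "agree_upto M k c d" for k
      using cball_carrier[OF M c, of k] by (auto simp: agree_upto_def)
    then show False using glob by blast
  qed
  ultimately show "\<exists>y\<in>U. fst y \<cong> G \<and> \<not> marked_equiv x y" using MG by force
qed

section \<open>The wreath product\<close>

lemma carrier_wreath: "carrier (wreath B H) = (carrier H \<rightarrow>\<^sub>E carrier B) \<times> carrier H"
  by (simp add: wreath_def)

lemma mult_wreath:
  "(f, h) \<otimes>\<^bsub>wreath B H\<^esub> (f', h') =
     ((\<lambda>x\<in>carrier H. f x \<otimes>\<^bsub>B\<^esub> f' (inv\<^bsub>H\<^esub> h \<otimes>\<^bsub>H\<^esub> x)), h \<otimes>\<^bsub>H\<^esub> h')"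
  by (simp add: wreath_def)

lemma one_wreath: "\<one>\<^bsub>wreath B H\<^esub> = ((\<lambda>x\<in>carrier H. \<one>\<^bsub>B\<^esub>), \<one>\<^bsub>H\<^esub>)"
  by (simp add: wreath_def)

lemma group_wreath:
  assumes B: "group B" and H: "group H"
  shows "group (wreath B H)"
proof -
  interpret B: group B by (rule B)
  interpret H: group H by (rule H)
  let ?W = "wreath B H"
  show ?thesis
  proof (rule groupI)
    show "\<one>\<^bsub>?W\<^esub> \<in> carrier ?W" by (simp add: one_wreath carrier_wreath)
    fix u assume u: "u \<in> carrier ?W"
    obtain f h where fh: "u = (f, h)" by (cases u)
    have f: "f \<in> carrier H \<rightarrow>\<^sub>E carrier B" "h \<in> carrier H" using u fh by (auto simp: carrier_wreath)
    have fc: "f x \<in> carrier B" if "x \<in> carrier H" for x using f(1) that by auto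
    show "\<one>\<^bsub>?W\<^esub> \<otimes>\<^bsub>?W\<^esub> u = u"
    proof -
      have "(\<lambda>x\<in>carrier H. (\<lambda>x\<in>carrier H. \<one>\<^bsub>B\<^esub>) x \<otimes>\<^bsub>B\<^esub> f (inv\<^bsub>H\<^esub> \<one>\<^bsub>H\<^esub> \<otimes>\<^bsub>H\<^esub> x)) = f"
        by (rule extensionalityI[of _ "carrier H"]) (use f(1) in \<open>simp_all add: fc PiE_def\<close>)
      then show ?thesis using f(2) by (simp add: fh one_wreath mult_wreath)
    qed
    \<comment> \<open>The left inverse of \<open>f h\<close>: the pointwise inverse of
      \<open>f\<close>, translated by \<open>h\<close>, together with the inverse of
      \<open>h\<close>.\<close>
    have "((\<lambda>x\<in>carrier H. inv\<^bsub>B\<^esub> f (h \<otimes>\<^bsub>H\<^esub> x)), inv\<^bsub>H\<^esub> h) \<otimes>\<^bsub>?W\<^esub> u = \<one>\<^bsub>?W\<^esub>"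
      unfolding fh one_wreath mult_wreath prod.inject using f(2)
      by (intro conjI restrict_ext) (simp_all add: fc)
    moreover have "((\<lambda>x\<in>carrier H. inv\<^bsub>B\<^esub> f (h \<otimes>\<^bsub>H\<^esub> x)), inv\<^bsub>H\<^esub> h) \<in> carrier ?W"
      using f(2) by (simp add: carrier_wreath fc)
    ultimately show "\<exists>v\<in>carrier ?W. v \<otimes>\<^bsub>?W\<^esub> u = \<one>\<^bsub>?W\<^esub>" by blast
    fix v assume v: "v \<in> carrier ?W"
    obtain f' h' where fh': "v = (f', h')" by (cases v)
    have f': "f' \<in> carrier H \<rightarrow>\<^sub>E carrier B" "h' \<in> carrier H" using v fh' by (auto simp: carrier_wreath)
    have fc': "f' x \<in> carrier B" if "x \<in> carrier H" for x using f'(1) that by auto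
    show "u \<otimes>\<^bsub>?W\<^esub> v \<in> carrier ?W"
      using f(2) f'(2) by (simp add: fh fh' mult_wreath carrier_wreath fc fc')
    fix w assume w: "w \<in> carrier ?W"
    obtain f'' h'' where fh'': "w = (f'', h'')" by (cases w)
    have f'': "f'' \<in> carrier H \<rightarrow>\<^sub>E carrier B" "h'' \<in> carrier H" using w fh'' by (auto simp: carrier_wreath)
    have fc'': "f'' x \<in> carrier B" if "x \<in> carrier H" for x using f''(1) that by auto
    show "u \<otimes>\<^bsub>?W\<^esub> v \<otimes>\<^bsub>?W\<^esub> w = u \<otimes>\<^bsub>?W\<^esub> (v \<otimes>\<^bsub>?W\<^esub> w)"
      unfolding fh fh' fh'' mult_wreath prod.inject using f(2) f'(2) f''(2)
      by (intro conjI restrict_ext) (simp_all add: fc fc' fc'' B.m_assoc H.m_assoc H.inv_mult_group)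
  qed
qed

section \<open>Sparse sets\<close>

text \<open>The points are chosen one after another: balls are finite, so finitely many earlier
  points exclude only finitely many candidates.\<close>

lemma exists_sparse_set:
  assumes H: "group H" and s: "range s \<subseteq> carrier H" "finite (range s)" and inf: "infinite (carrier H)"
  shows "\<exists>D. D \<subseteq> carrier H \<and> infinite D \<and>
    (\<forall>r. finite {y\<in>D. \<exists>z\<in>D. z \<noteq> y \<and> z \<otimes>\<^bsub>H\<^esub> inv\<^bsub>H\<^esub> y \<in> cball H s r})"
proof -
  interpret group H by (rule H)
  have "\<exists>x::nat \<Rightarrow> _. \<forall>n. x n \<in> carrier H \<and> (\<forall>i<n. x n \<notin> (\<lambda>e. e \<otimes>\<^bsub>H\<^esub> x i) ` cball H s n)"
  proof (rule dependent_wellorder_choice)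
    fix n :: nat and x :: "nat \<Rightarrow> _"
    have "finite (\<Union>i<n. (\<lambda>e. e \<otimes>\<^bsub>H\<^esub> x i) ` cball H s n)"
      using finite_cball[OF s(2)] by auto
    then obtain g where "g \<in> carrier H" "g \<notin> (\<Union>i<n. (\<lambda>e. e \<otimes>\<^bsub>H\<^esub> x i) ` cball H s n)"
      using inf by (meson finite_subset subsetI)
    then show "\<exists>g. g \<in> carrier H \<and> (\<forall>i<n. g \<notin> (\<lambda>e. e \<otimes>\<^bsub>H\<^esub> x i) ` cball H s n)" by blast
  qed auto
  then obtain x :: "nat \<Rightarrow> _" where x: "\<And>n. x n \<in> carrier H"
    and sep: "\<And>n i. i < n \<Longrightarrow> x n \<notin> (\<lambda>e. e \<otimes>\<^bsub>H\<^esub> x i) ` cball H s n" by blast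
  have far: "x n \<otimes>\<^bsub>H\<^esub> inv\<^bsub>H\<^esub> x i \<notin> cball H s n" if "i < n" for n i
  proof
    assume "x n \<otimes>\<^bsub>H\<^esub> inv\<^bsub>H\<^esub> x i \<in> cball H s n"
    moreover have "x n = x n \<otimes>\<^bsub>H\<^esub> inv\<^bsub>H\<^esub> x i \<otimes>\<^bsub>H\<^esub> x i" using x by (simp add: m_assoc)
    ultimately show False using sep[OF that] by blast
  qed
  have "x i \<noteq> x n" if "i < n" for i n
    using far[OF that] x one_in_cball[of H s n] by (metis r_inv)
  then have "inj x" by (metis linorder_injI)
  then have "infinite (range x)" by (rule range_inj_infinite)
  moreover have "finite {y\<in>range x. \<exists>z\<in>range x. z \<noteq> y \<and> z \<otimes>\<^bsub>H\<^esub> inv\<^bsub>H\<^esub> y \<in> cball H s r}" for r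
  proof (rule finite_subset)
    \<comment> \<open>Balls are closed under inversion, so of two near points the one with larger
      index may be put first, and this index is the separation radius. Hence a bad point has index
      below \<open>r\<close>.\<close>
    show "{y\<in>range x. \<exists>z\<in>range x. z \<noteq> y \<and> z \<otimes>\<^bsub>H\<^esub> inv\<^bsub>H\<^esub> y \<in> cball H s r} \<subseteq> x ` {..<r}"
    proof clarify
      fix n i assume ne: "x i \<noteq> x n" and near: "x i \<otimes>\<^bsub>H\<^esub> inv\<^bsub>H\<^esub> x n \<in> cball H s r"
      have near': "x n \<otimes>\<^bsub>H\<^esub> inv\<^bsub>H\<^esub> x i \<in> cball H s r"
        using cball_inv[OF H s(1) near] x by (simp add: inv_mult_group)
      have "n < r"
      proof (rule ccontr)
        assume "\<not> n < r"
        then have sub: "cball H s r \<subseteq> cball H s n" by (intro cball_mono) simp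
        consider "i < n" | "n < i" using ne by (metis linorder_neqE_nat)
        then show False
        proof cases
          case 1 then show ?thesis using far near' sub by blast
        next
          case 2 then show ?thesis using far[OF 2] near sub cball_mono[of n i H s] by auto
        qed
      qed
      then show "x n \<in> x ` {..<r}" by blast
    qed
  qed simp
  ultimately show ?thesis using x by (intro exI[of _ "range x"]) blast
qed

section \<open>The condensed subgroup\<close>

definition supp_fun :: "'b monoid \<Rightarrow> 'h monoid \<Rightarrow> 'b \<Rightarrow> 'h set \<Rightarrow> ('h \<Rightarrow> 'b) \<times> 'h" where
  "supp_fun B H t Y = ((\<lambda>x\<in>carrier H. if x \<in> Y then t else \<one>\<^bsub>B\<^esub>), \<one>\<^bsub>H\<^esub>)"

definition top_elt :: "'b monoid \<Rightarrow> 'h monoid \<Rightarrow> 'h \<Rightarrow> ('h \<Rightarrow> 'b) \<times> 'h" where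
  "top_elt B H h = ((\<lambda>x\<in>carrier H. \<one>\<^bsub>B\<^esub>), h)"

text \<open>Only entry 0 depends on \<open>D\<close>, so the tuples of two sets share all other
  entries. The generators of \<open>H\<close> start at position 3.\<close>

fun gens :: "'b monoid \<Rightarrow> 'h monoid \<Rightarrow> 'b \<Rightarrow> 'b \<Rightarrow> (nat \<Rightarrow> 'h) \<Rightarrow> 'h set \<Rightarrow> nat \<Rightarrow> ('h \<Rightarrow> 'b) \<times> 'h" where
  "gens B H a b s D 0 = supp_fun B H b D"
| "gens B H a b s D (Suc 0) = supp_fun B H a {\<one>\<^bsub>H\<^esub>}"
| "gens B H a b s D (Suc (Suc 0)) = supp_fun B H b {\<one>\<^bsub>H\<^esub>}"
| "gens B H a b s D (Suc (Suc (Suc i))) = top_elt B H (s i)"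

context
  fixes B :: "'b monoid" and H :: "'h monoid" and s :: "nat \<Rightarrow> 'h" and a b :: 'b
  assumes B: "group B" and H: "group H" and s: "range s \<subseteq> carrier H"
    and a: "a \<in> carrier B" and b: "b \<in> carrier B"
begin

interpretation B: group B by (rule B)
interpretation H: group H by (rule H)
interpretation W: group "wreath B H" by (rule group_wreath[OF B H])

abbreviation (input) "\<W> \<equiv> wreath B H"

section \<open>Computing with the generators\<close>

lemma supp_fun_closed: "t \<in> carrier B \<Longrightarrow> supp_fun B H t Y \<in> carrier \<W>"
  by (auto simp: supp_fun_def carrier_wreath)

lemma top_elt_closed: "h \<in> carrier H \<Longrightarrow> top_elt B H h \<in> carrier \<W>"
  by (auto simp: top_elt_def carrier_wreath)

lemma gens_closed: "range (gens B H a b s D) \<subseteq> carrier \<W>"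
proof -
  have "gens B H a b s D i \<in> carrier \<W>" for i
    using a b s
    by (cases "(B, H, a, b, s, D, i)" rule: gens.cases) (auto intro!: supp_fun_closed top_elt_closed)
  then show ?thesis by blast
qed

lemma finite_range_gens:
  assumes "finite (range s)" shows "finite (range (gens B H a b s D))"
proof (rule finite_subset)
  have "gens B H a b s D i \<in> {supp_fun B H b D, supp_fun B H a {\<one>\<^bsub>H\<^esub>}, supp_fun B H b {\<one>\<^bsub>H\<^esub>}}
      \<union> top_elt B H ` range s" for i
    by (cases "(B, H, a, b, s, D, i)" rule: gens.cases) auto
  then show "range (gens B H a b s D) \<subseteq> {supp_fun B H b D, supp_fun B H a {\<one>\<^bsub>H\<^esub>}, supp_fun B H b {\<one>\<^bsub>H\<^esub>}}
      \<union> top_elt B H ` range s" by blast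
qed (use assms in auto)

lemma inv_supp_fun:
  assumes "t \<in> carrier B"
  shows "inv\<^bsub>\<W>\<^esub> supp_fun B H t Y = supp_fun B H (inv\<^bsub>B\<^esub> t) Y"
proof (rule W.inv_equality)
  show "supp_fun B H (inv\<^bsub>B\<^esub> t) Y \<otimes>\<^bsub>\<W>\<^esub> supp_fun B H t Y = \<one>\<^bsub>\<W>\<^esub>"
    unfolding supp_fun_def mult_wreath one_wreath prod.inject using assms
    by (intro conjI restrict_ext) simp_all
qed (use assms in \<open>simp_all add: supp_fun_closed\<close>)

lemma inv_top_elt:
  assumes "h \<in> carrier H"
  shows "inv\<^bsub>\<W>\<^esub> top_elt B H h = top_elt B H (inv\<^bsub>H\<^esub> h)"
proof (rule W.inv_equality)
  show "top_elt B H (inv\<^bsub>H\<^esub> h) \<otimes>\<^bsub>\<W>\<^esub> top_elt B H h = \<one>\<^bsub>\<W>\<^esub>"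
    unfolding top_elt_def mult_wreath one_wreath prod.inject using assms
    by (intro conjI restrict_ext) simp_all
qed (use assms in \<open>simp_all add: top_elt_closed\<close>)

lemma top_elt_hom: "top_elt B H \<in> hom H \<W>"
proof (rule homI)
  fix h k assume "h \<in> carrier H" "k \<in> carrier H"
  then show "top_elt B H (h \<otimes>\<^bsub>H\<^esub> k) = top_elt B H h \<otimes>\<^bsub>\<W>\<^esub> top_elt B H k"
    unfolding top_elt_def mult_wreath prod.inject by (intro conjI restrict_ext) simp_all
qed (rule top_elt_closed)

text \<open>Conjugation by \<open>h\<close> moves the support from 1 to \<open>h\<close>, so the
  letters supported at 1 and the copy of \<open>H\<close> produce point functions
  everywhere.\<close>

lemma conj_supp_fun:
  assumes "h \<in> carrier H" "t \<in> carrier B"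
  shows "top_elt B H h \<otimes>\<^bsub>\<W>\<^esub> supp_fun B H t {\<one>\<^bsub>H\<^esub>} \<otimes>\<^bsub>\<W>\<^esub> inv\<^bsub>\<W>\<^esub> top_elt B H h = supp_fun B H t {h}"
proof -
  have "inv\<^bsub>H\<^esub> h \<otimes>\<^bsub>H\<^esub> x = \<one>\<^bsub>H\<^esub> \<longleftrightarrow> x = h" if "x \<in> carrier H" for x
    using that assms(1) by (metis H.inv_closed H.inv_inv H.inv_equality H.l_inv H.inv_solve_left H.r_one H.one_closed)
  then show ?thesis
    unfolding inv_top_elt[OF assms(1)] unfolding top_elt_def supp_fun_def mult_wreath prod.inject
    using assms by (intro conjI restrict_ext) simp_all
qed

lemma supp_fun_mult_disjoint:
  assumes "t \<in> carrier B" "Y \<inter> Z = {}"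
  shows "supp_fun B H t Y \<otimes>\<^bsub>\<W>\<^esub> supp_fun B H t Z = supp_fun B H t (Y \<union> Z)"
  unfolding supp_fun_def mult_wreath prod.inject
  by (intro conjI restrict_ext) (use assms in auto)

lemma supp_fun_commute_disjoint:
  assumes "t \<in> carrier B" "t' \<in> carrier B" "Y \<inter> Z = {}"
  shows "supp_fun B H t Y \<otimes>\<^bsub>\<W>\<^esub> supp_fun B H t' Z = supp_fun B H t' Z \<otimes>\<^bsub>\<W>\<^esub> supp_fun B H t Y"
  unfolding supp_fun_def mult_wreath prod.inject
  by (intro conjI restrict_ext) (use assms in auto)

lemma supp_fun_commuteD:
  assumes "t \<in> carrier B" "t' \<in> carrier B" "y \<in> Y" "y \<in> Z" "y \<in> carrier H"
    and "supp_fun B H t Y \<otimes>\<^bsub>\<W>\<^esub> supp_fun B H t' Z = supp_fun B H t' Z \<otimes>\<^bsub>\<W>\<^esub> supp_fun B H t Y"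
  shows "t \<otimes>\<^bsub>B\<^esub> t' = t' \<otimes>\<^bsub>B\<^esub> t"
  using arg_cong[OF assms(6), of "\<lambda>w. fst w y"] assms(1-5)
  by (simp add: supp_fun_def mult_wreath)

section \<open>Values of short words\<close>

lemma mult_supp_fun:
  assumes "h \<in> carrier H"
  shows "(f, h) \<otimes>\<^bsub>\<W>\<^esub> supp_fun B H t Y
    = ((\<lambda>x\<in>carrier H. f x \<otimes>\<^bsub>B\<^esub> (if inv\<^bsub>H\<^esub> h \<otimes>\<^bsub>H\<^esub> x \<in> Y then t else \<one>\<^bsub>B\<^esub>)), h)"
  unfolding supp_fun_def mult_wreath prod.inject using assms
  by (intro conjI restrict_ext) simp_all

lemma mult_top_elt:
  assumes "(f, h) \<in> carrier \<W>" "k \<in> carrier H"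
  shows "(f, h) \<otimes>\<^bsub>\<W>\<^esub> top_elt B H k = (f, h \<otimes>\<^bsub>H\<^esub> k)"
proof -
  have f: "f \<in> carrier H \<rightarrow>\<^sub>E carrier B" "h \<in> carrier H" using assms(1) by (simp_all add: carrier_wreath)
  then have fc: "f x \<in> carrier B" if "x \<in> carrier H" for x using that by auto
  have "(\<lambda>x\<in>carrier H. f x \<otimes>\<^bsub>B\<^esub> (\<lambda>x\<in>carrier H. \<one>\<^bsub>B\<^esub>) (inv\<^bsub>H\<^esub> h \<otimes>\<^bsub>H\<^esub> x)) = f"
    by (rule extensionalityI[of _ "carrier H"]) (use f fc in \<open>simp_all add: PiE_def\<close>)
  then show ?thesis by (simp add: top_elt_def mult_wreath)
qed

text \<open>The case distinction for induction on words. Inverse letters are absorbed by letting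
  \<open>t\<close> range over \<open>B\<close> and \<open>k\<close> over the ball of radius
  1.\<close>

lemma gens_letter:
  assumes "p \<in> range (\<lambda>i. (gens B H a b s D i, gens B H a b s D' i)) \<or>
    p \<in> (\<lambda>t. inv\<^bsub>\<W> \<times>\<times> \<W>\<^esub> t) ` range (\<lambda>i. (gens B H a b s D i, gens B H a b s D' i))"
  obtains (base) t where "t \<in> carrier B" "p = (supp_fun B H t D, supp_fun B H t D')"
    | (point) t where "t \<in> carrier B" "p = (supp_fun B H t {\<one>\<^bsub>H\<^esub>}, supp_fun B H t {\<one>\<^bsub>H\<^esub>})"
    | (top) k where "k \<in> cball H s (Suc 0)" "p = (top_elt B H k, top_elt B H k)"
proof -
  obtain i where "p = (gens B H a b s D i, gens B H a b s D' i) \<or>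
      p = (inv\<^bsub>\<W>\<^esub> gens B H a b s D i, inv\<^bsub>\<W>\<^esub> gens B H a b s D' i)"
  proof -
    have "inv\<^bsub>\<W> \<times>\<times> \<W>\<^esub> (gens B H a b s D i, gens B H a b s D' i) =
        (inv\<^bsub>\<W>\<^esub> gens B H a b s D i, inv\<^bsub>\<W>\<^esub> gens B H a b s D' i)" for i
      using gens_closed[of D] gens_closed[of D']
      by (intro inv_DirProd[OF group_wreath[OF B H] group_wreath[OF B H]]) auto
    then show ?thesis using assms that by (elim disjE rangeE imageE) metis+
  qed
  moreover have sj: "s j \<in> carrier H" for j using s by auto
  note inv = inv_supp_fun[OF a] inv_supp_fun[OF b] inv_top_elt[OF sj]
  ultimately show ?thesis
    using base[OF b] base[OF B.inv_closed[OF b]] point[OF a] point[OF B.inv_closed[OF a]]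
      point[OF b] point[OF B.inv_closed[OF b]] top[OF gen_in_cball(1)[OF H s]] top[OF gen_in_cball(2)[OF H s]]
    by (cases "(B, H, a, b, s, D, i)" rule: gens.cases) (auto simp: inv)
qed

text \<open>If the word read so far has \<open>H\<close>-part \<open>p\<close>, then reading entry 0
  next affects the value at \<open>x\<close> only if the inverse of \<open>p\<close> times
  \<open>x\<close> lies in \<open>D\<close>. The pattern collects these \<open>p\<close>.\<close>

definition pattern where
  "pattern D x = {p \<in> carrier H. inv\<^bsub>H\<^esub> p \<otimes>\<^bsub>H\<^esub> x \<in> D}"

text \<open>One \<open>\<Phi>\<close> serves both sets and sees only the pattern within radius
  \<open>r\<close>. The ball around 1 is excluded because letters supported at 1 contribute
  there.\<close>

definition locally_determined where
  "locally_determined D D' r f f' \<longleftrightarrow>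
    (\<exists>\<Phi>. \<Phi> {} = \<one>\<^bsub>B\<^esub> \<and> (\<forall>P. \<Phi> (P \<inter> cball H s r) = \<Phi> P) \<and>
      (\<forall>x\<in>carrier H - cball H s r. f x = \<Phi> (pattern D x) \<and> f' x = \<Phi> (pattern D' x)))"

lemma locally_determined_mono:
  assumes "locally_determined D D' r f f'"
  shows "locally_determined D D' (Suc r) f f'"
proof -
  obtain \<Phi> where \<Phi>: "\<Phi> {} = \<one>\<^bsub>B\<^esub>" "\<And>P. \<Phi> (P \<inter> cball H s r) = \<Phi> P"
    "\<And>x. x \<in> carrier H - cball H s r \<Longrightarrow> f x = \<Phi> (pattern D x) \<and> f' x = \<Phi> (pattern D' x)"
    using assms unfolding locally_determined_def by metis
  have sub: "cball H s r \<subseteq> cball H s (Suc r)" by (rule cball_mono) simp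
  have "\<Phi> (P \<inter> cball H s (Suc r)) = \<Phi> P" for P
    using \<Phi>(2)[of "P \<inter> cball H s (Suc r)"] \<Phi>(2)[of P] sub by (simp add: Int_assoc Int_absorb1)
  then show ?thesis unfolding locally_determined_def
    using \<Phi>(1,3) sub by (intro exI[of _ \<Phi>]) blast
qed

text \<open>Induction on \<open>r\<close> with \<open>R\<close> fixed. For \<open>x\<close> near 1,
  membership is tested only at points in the ball of radius \<open>R + K\<close>, where the two sets
  agree. Far from 1 only entry 0 and its inverse change a value, and their effect is read off the
  pattern.\<close>

lemma pair_ball_structure:
  assumes same: "\<And>x. x \<in> cball H s (R + K) \<Longrightarrow> x \<in> D \<longleftrightarrow> x \<in> D'"
    and "r \<le> R" "((f, h), (f', h')) \<in> pair_ball \<W> (gens B H a b s D) (gens B H a b s D') r"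
  shows "h' = h \<and> h \<in> cball H s r \<and> (\<forall>x\<in>cball H s K. f x = f' x) \<and> locally_determined D D' r f f'"
  using assms(2,3)
proof (induction r arbitrary: f h f' h')
  case 0
  then have "f = (\<lambda>x\<in>carrier H. \<one>\<^bsub>B\<^esub>)" "f' = (\<lambda>x\<in>carrier H. \<one>\<^bsub>B\<^esub>)" "h = \<one>\<^bsub>H\<^esub>" "h' = \<one>\<^bsub>H\<^esub>"
    by (auto simp: pair_ball_def one_wreath)
  then show ?case by (auto simp: locally_determined_def intro!: exI[of _ "\<lambda>_. \<one>\<^bsub>B\<^esub>"])
next
  case (Suc r)
  have sub: "cball H s r \<subseteq> cball H s (Suc r)" by (rule cball_mono) simp
  consider (old) "((f, h), (f', h')) \<in> pair_ball \<W> (gens B H a b s D) (gens B H a b s D') r"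
    | (new) g k g' k' p where "((g, k), (g', k')) \<in> pair_ball \<W> (gens B H a b s D) (gens B H a b s D') r"
      "((f, h), (f', h')) = ((g, k) \<otimes>\<^bsub>\<W>\<^esub> fst p, (g', k') \<otimes>\<^bsub>\<W>\<^esub> snd p)"
      "p \<in> range (\<lambda>i. (gens B H a b s D i, gens B H a b s D' i)) \<or>
       p \<in> (\<lambda>t. inv\<^bsub>\<W> \<times>\<times> \<W>\<^esub> t) ` range (\<lambda>i. (gens B H a b s D i, gens B H a b s D' i))"
  proof -
    have "((f, h), (f', h')) \<in> pair_ball \<W> (gens B H a b s D) (gens B H a b s D') r \<or>
      (\<exists>q p. ((f, h), (f', h')) = q \<otimes>\<^bsub>\<W> \<times>\<times> \<W>\<^esub> p \<and> q \<in> pair_ball \<W> (gens B H a b s D) (gens B H a b s D') r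
        \<and> (p \<in> range (\<lambda>i. (gens B H a b s D i, gens B H a b s D' i)) \<or>
          p \<in> (\<lambda>t. inv\<^bsub>\<W> \<times>\<times> \<W>\<^esub> t) ` range (\<lambda>i. (gens B H a b s D i, gens B H a b s D' i))))"
      using Suc.prems(2) unfolding pair_ball_def cball.simps Un_iff mem_Collect_eq .
    then show ?thesis
    proof (rule disjE, goal_cases)
      case 2
      then obtain q p where eq: "((f, h), (f', h')) = q \<otimes>\<^bsub>\<W> \<times>\<times> \<W>\<^esub> p"
        and q: "q \<in> pair_ball \<W> (gens B H a b s D) (gens B H a b s D') r"
        and p: "p \<in> range (\<lambda>i. (gens B H a b s D i, gens B H a b s D' i)) \<or>
          p \<in> (\<lambda>t. inv\<^bsub>\<W> \<times>\<times> \<W>\<^esub> t) ` range (\<lambda>i. (gens B H a b s D i, gens B H a b s D' i))"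
        by blast
      obtain g k g' k' where "q = ((g, k), (g', k'))" by (metis surj_pair)
      then show ?thesis
        using new[OF _ _ p, of g k g' k'] eq q by (cases p) simp
    qed (rule old)
  qed
  then show ?case
  proof cases
    case old
    then show ?thesis using Suc.IH[OF _ old] Suc.prems(1) sub locally_determined_mono by auto
  next
    case new
    have k': "k' = k" and k: "k \<in> cball H s r" and near: "\<And>x. x \<in> cball H s K \<Longrightarrow> g x = g' x"
      and far: "locally_determined D D' r g g'"
      using Suc.IH[OF _ new(1)] Suc.prems(1) by auto
    have kc: "k \<in> carrier H" using k cball_carrier[OF H s] by blast
    have gk: "(g, k) \<in> carrier \<W>" "(g', k) \<in> carrier \<W>"
      using pair_ball_carrier[OF group_wreath[OF B H] gens_closed gens_closed new(1)] k' by auto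
    then have gc: "g x \<in> carrier B" "g' x \<in> carrier B" if "x \<in> carrier H" for x
      using that by (auto simp: carrier_wreath)
    have ik: "inv\<^bsub>H\<^esub> k \<otimes>\<^bsub>H\<^esub> x \<in> cball H s (R + K)" if "x \<in> cball H s K" for x
      using cball_mult[OF H s cball_inv[OF H s k] that] Suc.prems(1) cball_mono[of "r + K" "R + K" H s] by auto
    from new(3) show ?thesis
    proof (cases rule: gens_letter)
      case (base t)
      have fh: "f = (\<lambda>x\<in>carrier H. g x \<otimes>\<^bsub>B\<^esub> (if inv\<^bsub>H\<^esub> k \<otimes>\<^bsub>H\<^esub> x \<in> D then t else \<one>\<^bsub>B\<^esub>))"
        "f' = (\<lambda>x\<in>carrier H. g' x \<otimes>\<^bsub>B\<^esub> (if inv\<^bsub>H\<^esub> k \<otimes>\<^bsub>H\<^esub> x \<in> D' then t else \<one>\<^bsub>B\<^esub>))" "h = k" "h' = k"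
        using new(2) unfolding base k' fst_conv snd_conv mult_supp_fun[OF kc] by auto
      obtain \<Phi> where \<Phi>: "\<Phi> {} = \<one>\<^bsub>B\<^esub>" "\<And>P. \<Phi> (P \<inter> cball H s (Suc r)) = \<Phi> P"
        "\<And>x. x \<in> carrier H - cball H s (Suc r) \<Longrightarrow> g x = \<Phi> (pattern D x) \<and> g' x = \<Phi> (pattern D' x)"
        using locally_determined_mono[OF far] unfolding locally_determined_def by metis
      have "locally_determined D D' (Suc r) f f'"
        unfolding locally_determined_def
      proof (intro exI conjI allI ballI)
        \<comment> \<open>The new letter multiplies the value at \<open>x\<close> by
          \<open>t\<close> exactly if \<open>k\<close> lies in the pattern of \<open>x\<close>. As
          \<open>k\<close> has length at most \<open>r\<close>, the dependence stays local.\<close>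
        let ?\<Psi> = "\<lambda>P. \<Phi> P \<otimes>\<^bsub>B\<^esub> (if k \<in> P then t else \<one>\<^bsub>B\<^esub>)"
        show "?\<Psi> {} = \<one>\<^bsub>B\<^esub>" using \<Phi>(1) by simp
        show "?\<Psi> (P \<inter> cball H s (Suc r)) = ?\<Psi> P" for P using \<Phi>(2) k sub by auto
        fix x assume x: "x \<in> carrier H - cball H s (Suc r)"
        then show "f x = ?\<Psi> (pattern D x)" "f' x = ?\<Psi> (pattern D' x)"
          unfolding fh using \<Phi>(3)[OF x] kc by (simp_all add: pattern_def)
      qed
      moreover have "f x = f' x" if "x \<in> cball H s K" for x
        using near[OF that] same[OF ik[OF that]] by (simp add: fh)
      ultimately show ?thesis using fh(3,4) k sub by blast
    next
      case (point t)
      have fh: "f = (\<lambda>x\<in>carrier H. g x \<otimes>\<^bsub>B\<^esub> (if inv\<^bsub>H\<^esub> k \<otimes>\<^bsub>H\<^esub> x \<in> {\<one>\<^bsub>H\<^esub>} then t else \<one>\<^bsub>B\<^esub>))"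
        "f' = (\<lambda>x\<in>carrier H. g' x \<otimes>\<^bsub>B\<^esub> (if inv\<^bsub>H\<^esub> k \<otimes>\<^bsub>H\<^esub> x \<in> {\<one>\<^bsub>H\<^esub>} then t else \<one>\<^bsub>B\<^esub>))" "h = k" "h' = k"
        using new(2) unfolding point k' fst_conv snd_conv mult_supp_fun[OF kc] by auto
      \<comment> \<open>A letter supported at 1, read at \<open>H\<close>-part \<open>k\<close>,
        changes only the value at the point \<open>k\<close>, which lies in the excluded
        ball.\<close>
      have "f x = g x" "f' x = g' x" if x: "x \<in> carrier H - cball H s (Suc r)" for x
      proof -
        have "inv\<^bsub>H\<^esub> k \<otimes>\<^bsub>H\<^esub> x \<noteq> \<one>\<^bsub>H\<^esub>"
          using x k kc sub by (metis DiffD1 DiffD2 H.inv_solve_left H.one_closed H.r_one subsetD)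
        then show "f x = g x" "f' x = g' x" using x gc by (simp_all add: fh)
      qed
      then have "locally_determined D D' (Suc r) f f'"
        using locally_determined_mono[OF far] by (simp add: locally_determined_def)
      moreover have "f x = f' x" if "x \<in> cball H s K" for x using near[OF that] by (simp add: fh)
      ultimately show ?thesis using fh(3,4) k sub by blast
    next
      case (top l)
      have l: "l \<in> carrier H" using top(1) cball_carrier[OF H s] by blast
      have fh: "f = g" "f' = g'" "h = k \<otimes>\<^bsub>H\<^esub> l" "h' = k \<otimes>\<^bsub>H\<^esub> l"
        using new(2) unfolding top k' fst_conv snd_conv mult_top_elt[OF gk(1) l] mult_top_elt[OF gk(2) l] by auto
      then show ?thesis
        using cball_mult[OF H s k top(1)] locally_determined_mono[OF far] near by simp
    qed
  qed
qed

text \<open>A point of \<open>D\<close> coming from another \<open>q\<close> in the ball differs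
  from \<open>y\<close> by the inverse of \<open>q\<close> times \<open>p\<close>, of length at most
  \<open>2 * r\<close>; isolation makes it equal to \<open>y\<close>, so \<open>q = p\<close>. As
  \<open>y\<close> may lie outside \<open>D\<close>, the set with \<open>y\<close> removed is
  covered too.\<close>

lemma pattern_isolated:
  assumes D: "D \<subseteq> carrier H" and y: "y \<in> carrier H" and p: "p \<in> cball H s r"
    and iso: "\<And>z. z \<in> D \<Longrightarrow> z \<noteq> y \<Longrightarrow> z \<otimes>\<^bsub>H\<^esub> inv\<^bsub>H\<^esub> y \<notin> cball H s (2 * r)"
  shows "pattern D (p \<otimes>\<^bsub>H\<^esub> y) \<inter> cball H s r = (if y \<in> D then {p} else {})"
proof -
  have pc: "p \<in> carrier H" using p cball_carrier[OF H s] by blast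
  have q: "q = p \<and> y \<in> D" if "q \<in> cball H s r" "inv\<^bsub>H\<^esub> q \<otimes>\<^bsub>H\<^esub> (p \<otimes>\<^bsub>H\<^esub> y) \<in> D" for q
  proof -
    have qc: "q \<in> carrier H" using that cball_carrier[OF H s] by blast
    have "inv\<^bsub>H\<^esub> q \<otimes>\<^bsub>H\<^esub> (p \<otimes>\<^bsub>H\<^esub> y) \<otimes>\<^bsub>H\<^esub> inv\<^bsub>H\<^esub> y = inv\<^bsub>H\<^esub> q \<otimes>\<^bsub>H\<^esub> p"
      using qc pc y by (simp add: H.m_assoc)
    moreover have "inv\<^bsub>H\<^esub> q \<otimes>\<^bsub>H\<^esub> p \<in> cball H s (2 * r)"
      using cball_mult[OF H s cball_inv[OF H s that(1)] p] by (simp add: mult_2)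
    ultimately have eq: "inv\<^bsub>H\<^esub> q \<otimes>\<^bsub>H\<^esub> (p \<otimes>\<^bsub>H\<^esub> y) = y" using iso[OF that(2)] by metis
    then have "p \<otimes>\<^bsub>H\<^esub> y = q \<otimes>\<^bsub>H\<^esub> y" using qc pc y by (metis H.inv_solve_left H.m_closed)
    then show ?thesis using eq that(2) qc pc y by simp
  qed
  moreover have "inv\<^bsub>H\<^esub> p \<otimes>\<^bsub>H\<^esub> (p \<otimes>\<^bsub>H\<^esub> y) = y"
    using pc y by (simp add: H.m_assoc[symmetric])
  ultimately show ?thesis using p pc unfolding pattern_def by auto
qed

text \<open>The second isolated point \<open>y'\<close> survives the removal of \<open>y\<close> and
  shows the same one-point patterns, so the values lost near \<open>y\<close> still occur near
  \<open>y'\<close>.\<close>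

lemma agree_upto_remove_isolated:
  assumes D: "D \<subseteq> carrier H"
    and y: "y \<in> D" "y \<notin> cball H s (2 * r)"
      "\<And>z. z \<in> D \<Longrightarrow> z \<noteq> y \<Longrightarrow> z \<otimes>\<^bsub>H\<^esub> inv\<^bsub>H\<^esub> y \<notin> cball H s (2 * r)"
    and y': "y' \<in> D" "y' \<noteq> y" "y' \<notin> cball H s (2 * r)"
      "\<And>z. z \<in> D \<Longrightarrow> z \<noteq> y' \<Longrightarrow> z \<otimes>\<^bsub>H\<^esub> inv\<^bsub>H\<^esub> y' \<notin> cball H s (2 * r)"
  shows "agree_upto \<W> r (gens B H a b s D) (gens B H a b s (D - {y}))"
  unfolding agree_upto_def
proof clarify
  fix f h f' h'
  let ?D' = "D - {y}"
  assume pair: "((f, h), (f', h')) \<in> pair_ball \<W> (gens B H a b s D) (gens B H a b s ?D') r"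
  \<comment> \<open>Since \<open>y\<close> lies outside the ball of radius \<open>2 * r\<close>, the
    structure lemma applies with \<open>R = K = r\<close>.\<close>
  have "x \<in> D \<longleftrightarrow> x \<in> ?D'" if "x \<in> cball H s (r + r)" for x
    using that y(2) by (auto simp: mult_2)
  note str = pair_ball_structure[OF this order_refl pair]
  have h: "h' = h" and near: "\<And>x. x \<in> cball H s r \<Longrightarrow> f x = f' x"
    and far: "locally_determined D ?D' r f f'"
    using str by blast+
  obtain \<Phi> where \<Phi>: "\<Phi> {} = \<one>\<^bsub>B\<^esub>" "\<And>P. \<Phi> (P \<inter> cball H s r) = \<Phi> P"
    "\<And>x. x \<in> carrier H \<Longrightarrow> x \<notin> cball H s r \<Longrightarrow> f x = \<Phi> (pattern D x) \<and> f' x = \<Phi> (pattern ?D' x)"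
    using far unfolding locally_determined_def by auto
  have yc: "y \<in> carrier H" "y' \<in> carrier H" using D y(1) y'(1) by auto
  have D': "?D' \<subseteq> carrier H" using D by blast
  note rc = subsetD[OF cball_carrier[OF H s]]
  \<comment> \<open>At points \<open>p\<close> times \<open>y\<close> the two values can differ, so
    the equivalence is claimed only when one of the functions is trivial everywhere.\<close>
  have pts: "f x = \<one>\<^bsub>B\<^esub> \<longleftrightarrow> f' x = \<one>\<^bsub>B\<^esub>"
    if x: "x \<in> carrier H" and triv: "(\<forall>x\<in>carrier H. f x = \<one>\<^bsub>B\<^esub>) \<or> (\<forall>x\<in>carrier H. f' x = \<one>\<^bsub>B\<^esub>)" for x
  proof -
    consider (near) "x \<in> cball H s r"
      | (moved) p where "x \<notin> cball H s r" "p \<in> cball H s r" "x = p \<otimes>\<^bsub>H\<^esub> y"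
      | (far) "x \<notin> cball H s r" "\<And>p. p \<in> cball H s r \<Longrightarrow> x \<noteq> p \<otimes>\<^bsub>H\<^esub> y" by blast
    then show ?thesis
    proof cases
      case near
      then show ?thesis using \<open>\<And>x. x \<in> cball H s r \<Longrightarrow> f x = f' x\<close> by simp
    next
      case far
      have "pattern D x \<inter> cball H s r = pattern ?D' x \<inter> cball H s r"
      proof -
        have "inv\<^bsub>H\<^esub> p \<otimes>\<^bsub>H\<^esub> x \<noteq> y" if "p \<in> cball H s r" for p
          using far(2)[OF that] x rc[OF that] yc(1) by (metis H.inv_solve_left)
        then show ?thesis unfolding pattern_def by auto
      qed
      then show ?thesis using \<Phi>(2)[of "pattern D x"] \<Phi>(2)[of "pattern ?D' x"] \<Phi>(3)[OF x far(1)] by simp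
    next
      case (moved p)
      have pc: "p \<in> carrier H" using moved rc by blast
      have "pattern ?D' x \<inter> cball H s r = {}"
        using pattern_isolated[OF D' yc(1) moved(2)] y(3) unfolding moved(3) by simp
      then have f'x: "f' x = \<one>\<^bsub>B\<^esub>" using \<Phi>(1) \<Phi>(2)[of "pattern ?D' x"] \<Phi>(3)[OF x moved(1)] by simp
      have "pattern D x \<inter> cball H s r = {p}"
        using pattern_isolated[OF D yc(1) moved(2) y(3)] y(1) unfolding moved(3) by simp
      then have fx: "f x = \<Phi> {p}" using \<Phi>(2)[of "pattern D x"] \<Phi>(3)[OF x moved(1)] by simp
      \<comment> \<open>The pattern \<open>{p}\<close> lost at \<open>x\<close> still occurs at
        \<open>x'\<close> for the smaller set, so triviality of \<open>f'\<close> forces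
        \<open>\<Phi> {p}\<close> to be trivial. Triviality of \<open>f\<close> gives the same at
        \<open>x\<close> itself.\<close>
      define x' where "x' = p \<otimes>\<^bsub>H\<^esub> y'"
      have x': "x' \<in> carrier H" using pc yc by (simp add: x'_def)
      have "x' \<notin> cball H s r"
      proof
        assume "x' \<in> cball H s r"
        from cball_mult[OF H s cball_inv[OF H s moved(2)] this]
        show False using y'(3) pc yc by (simp add: x'_def mult_2 H.m_assoc[symmetric])
      qed
      moreover have "pattern ?D' x' \<inter> cball H s r = {p}"
        using pattern_isolated[OF D' yc(2) moved(2)] y'(1,2,4) unfolding x'_def by simp
      ultimately have "f' x' = \<Phi> {p}" using \<Phi>(2)[of "pattern ?D' x'"] \<Phi>(3)[OF x'] by simp
      then show ?thesis using fx f'x triv x x' by auto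
    qed
  qed
  have carr: "(f, h) \<in> carrier \<W>" "(f', h') \<in> carrier \<W>"
    using pair_ball_carrier[OF group_wreath[OF B H] gens_closed gens_closed pair] by auto
  have one: "(g, k) = \<one>\<^bsub>\<W>\<^esub> \<longleftrightarrow> k = \<one>\<^bsub>H\<^esub> \<and> (\<forall>x\<in>carrier H. g x = \<one>\<^bsub>B\<^esub>)" if "(g, k) \<in> carrier \<W>" for g k
  proof -
    have "g \<in> extensional (carrier H)" using that by (auto simp: carrier_wreath PiE_def)
    then have "g = (\<lambda>x\<in>carrier H. \<one>\<^bsub>B\<^esub>)" if "\<forall>x\<in>carrier H. g x = \<one>\<^bsub>B\<^esub>"
      by (rule extensionalityI) (use that in simp_all)
    then show ?thesis by (auto simp only: one_wreath prod.inject restrict_apply')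
  qed
  have "(\<forall>x\<in>carrier H. f x = \<one>\<^bsub>B\<^esub>) \<longleftrightarrow> (\<forall>x\<in>carrier H. f' x = \<one>\<^bsub>B\<^esub>)"
    using pts by (meson ballI)
  then show "(f, h) = \<one>\<^bsub>\<W>\<^esub> \<longleftrightarrow> (f', h') = \<one>\<^bsub>\<W>\<^esub>"
    using one[OF carr(1)] one[OF carr(2)] h by simp
qed

section \<open>Effect of removing a point on the subgroup and on its relations\<close>

lemma top_elt_pair:
  assumes "h \<in> cball H s k"
  shows "(top_elt B H h, top_elt B H h) \<in> pair_ball \<W> (gens B H a b s D) (gens B H a b s D') k"
proof -
  let ?t = "\<lambda>i. top_elt B H (s i)"
  have t: "range ?t \<subseteq> carrier \<W>" using s top_elt_closed by auto
  have "(?t i, ?t i) \<in> pair_ball \<W> (gens B H a b s D) (gens B H a b s D') 1" for i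
    using pair_ball_gen[OF group_wreath[OF B H] gens_closed gens_closed, where i = "Suc (Suc (Suc i))" and r = 0] by simp
  from pair_ball_refine[OF group_wreath[OF B H] gens_closed gens_closed, of ?t ?t, OF this]
  have "pair_ball \<W> ?t ?t k \<subseteq> pair_ball \<W> (gens B H a b s D) (gens B H a b s D') k" by simp
  moreover have "(\<lambda>h. (top_elt B H h, top_elt B H h)) \<in> hom H (\<W> \<times>\<times> \<W>)"
    using top_elt_hom by (auto simp: hom_def)
  from cball_hom[OF H DirProd_group[OF group_wreath[OF B H] group_wreath[OF B H]] this s, of k]
  have "(top_elt B H h, top_elt B H h) \<in> pair_ball \<W> ?t ?t k"
    using assms by (simp add: pair_ball_def)
  ultimately show ?thesis by blast
qed

text \<open>The letter supported at 1 is conjugated by a word for \<open>y\<close> in the generators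
  of \<open>H\<close>. Entry 0 does not occur, so the value is the same at both tuples.\<close>

lemma point_pair:
  assumes "generate H (range s) = carrier H" "y \<in> carrier H" "t \<in> {a, b}"
  shows "\<exists>k. (supp_fun B H t {y}, supp_fun B H t {y}) \<in> pair_ball \<W> (gens B H a b s D) (gens B H a b s D') k"
proof -
  note facts = group_wreath[OF B H] gens_closed[of D] gens_closed[of D']
  obtain k where "y \<in> cball H s k" using generate_imp_cball[OF H s] assms(1,2) by blast
  note y = top_elt_pair[OF this, of D D']
  have "(supp_fun B H t {\<one>\<^bsub>H\<^esub>}, supp_fun B H t {\<one>\<^bsub>H\<^esub>}) \<in> pair_ball \<W> (gens B H a b s D) (gens B H a b s D') 1"
    using assms(3) pair_ball_gen[OF facts, of "Suc 0" 0] pair_ball_gen[OF facts, of "Suc (Suc 0)" 0] by auto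
  from pair_ball_mult[OF facts pair_ball_mult[OF facts y this] pair_ball_inv[OF facts y]]
  show ?thesis using conj_supp_fun[OF assms(2)] a b assms(3) by auto
qed

text \<open>The two versions of entry 0 differ by the function with value \<open>b\<close> at
  \<open>y\<close> alone, which both subgroups contain.\<close>

lemma generate_gens_remove_point:
  assumes "generate H (range s) = carrier H" "y \<in> D" "D \<subseteq> carrier H"
  shows "generate \<W> (range (gens B H a b s (D - {y}))) = generate \<W> (range (gens B H a b s D))"
proof -
  let ?g = "gens B H a b s D" and ?g' = "gens B H a b s (D - {y})"
  note grp = group_wreath[OF B H]
  note facts = grp gens_closed[of D] gens_closed[of "D - {y}"]
  have y: "y \<in> carrier H" using assms by auto
  obtain k where k: "(supp_fun B H b {y}, supp_fun B H b {y}) \<in> pair_ball \<W> ?g ?g' k"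
    using point_pair[OF assms(1) y] by blast
  have pt: "supp_fun B H b {y} \<in> generate \<W> (range ?g)" "supp_fun B H b {y} \<in> generate \<W> (range ?g')"
    using k pair_ball_fst[OF facts, of k] pair_ball_snd[OF facts, of k]
      cball_subset_generate[OF grp gens_closed, of D k] cball_subset_generate[OF grp gens_closed, of "D - {y}" k]
    by force+
  have D: "supp_fun B H b (D - {y}) \<otimes>\<^bsub>\<W>\<^esub> supp_fun B H b {y} = supp_fun B H b D"
    using supp_fun_mult_disjoint[OF b, of "D - {y}" "{y}"] assms(2) by (simp add: insert_absorb)
  then have D': "supp_fun B H b (D - {y}) = supp_fun B H b D \<otimes>\<^bsub>\<W>\<^esub> inv\<^bsub>\<W>\<^esub> supp_fun B H b {y}"
    using b by (metis W.inv_solve_right supp_fun_closed)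
  have sub: "subgroup (generate \<W> (range ?g)) \<W>" "subgroup (generate \<W> (range ?g')) \<W>"
    by (rule W.generate_is_subgroup[OF gens_closed])+
  have same: "?g i = ?g' i" if "i \<noteq> 0" for i
    using that by (cases "(B, H, a, b, s, D, i)" rule: gens.cases) auto
  have "?g 0 \<in> generate \<W> (range ?g')"
    using generate.eng[OF generate.incl[OF rangeI[of ?g' 0]] pt(2)] D by simp
  then have "range ?g \<subseteq> generate \<W> (range ?g')"
    using same generate.incl[of _ "range ?g'"] by (metis image_subsetI rangeI)
  moreover have "?g' 0 \<in> generate \<W> (range ?g)"
    using generate.eng[OF generate.incl[OF rangeI[of ?g 0]] subgroup.m_inv_closed[OF sub(1) pt(1)]] D' by simp
  then have "range ?g' \<subseteq> generate \<W> (range ?g)"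
    using same generate.incl[of _ "range ?g"] by (metis image_subsetI rangeI)
  ultimately show ?thesis
    using W.generate_subgroup_incl sub by blast
qed

text \<open>Entry 0 commutes with the function of value \<open>a\<close> at \<open>y\<close> for the
  smaller set, the supports being disjoint. For \<open>D\<close> this would give \<open>a\<close>
  and \<open>b\<close> commuting, by evaluation at \<open>y\<close>.\<close>

lemma disagree_remove_point:
  assumes "generate H (range s) = carrier H" "y \<in> D" "D \<subseteq> carrier H" and ab: "a \<otimes>\<^bsub>B\<^esub> b \<noteq> b \<otimes>\<^bsub>B\<^esub> a"
  shows "\<exists>k. \<not> agree_upto \<W> k (gens B H a b s D) (gens B H a b s (D - {y}))"
proof (rule ccontr)
  let ?g = "gens B H a b s D" and ?g' = "gens B H a b s (D - {y})"
  note facts = group_wreath[OF B H] gens_closed[of D] gens_closed[of "D - {y}"]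
  assume "\<nexists>k. \<not> agree_upto \<W> k ?g ?g'"
  then have agree: "agree_upto \<W> k ?g ?g'" for k by blast
  have y: "y \<in> carrier H" using assms by auto
  obtain k where k: "(supp_fun B H a {y}, supp_fun B H a {y}) \<in> pair_ball \<W> ?g ?g' k"
    using point_pair[OF assms(1) y] by blast
  have g: "(supp_fun B H b D, supp_fun B H b (D - {y})) \<in> pair_ball \<W> ?g ?g' 1"
    using pair_ball_gen[OF facts, of 0 0] by simp
  have "supp_fun B H a {y} \<otimes>\<^bsub>\<W>\<^esub> supp_fun B H b D = supp_fun B H b D \<otimes>\<^bsub>\<W>\<^esub> supp_fun B H a {y}"
    using pair_ball_eq_iff[OF facts agree pair_ball_mult[OF facts k g] pair_ball_mult[OF facts g k] order_refl]
      supp_fun_commute_disjoint[OF a b, of "{y}" "D - {y}"] by simp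
  from supp_fun_commuteD[OF a b _ assms(2) y this] ab show False by simp
qed

end

theorem theorem1p2:
  fixes B :: "'b monoid" and H :: "'h monoid"
  assumes "group B"
    and "\<exists>x\<in>carrier B. \<exists>y\<in>carrier B. x \<otimes>\<^bsub>B\<^esub> y \<noteq> y \<otimes>\<^bsub>B\<^esub> x"
    and "group H" and "fin_gen H" and "infinite (carrier H)"
  shows "\<exists>S. subgroup S (wreath B H) \<and> fin_gen ((wreath B H)\<lparr>carrier := S\<rparr>)
             \<and> condensed ((wreath B H)\<lparr>carrier := S\<rparr>)"
proof -
  note B = assms(1) and H = assms(3)
  interpret H: group H by (rule H)
  interpret W: group "wreath B H" by (rule group_wreath[OF B H])
  obtain a b where a: "a \<in> carrier B" and b: "b \<in> carrier B" and ab: "a \<otimes>\<^bsub>B\<^esub> b \<noteq> b \<otimes>\<^bsub>B\<^esub> a"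
    using assms(2) by blast
  obtain T where T: "finite T" "T \<subseteq> carrier H" "generate H T = carrier H"
    using assms(4) by (auto simp: fin_gen_def)
  obtain xs where xs: "set xs = T" using finite_list[OF T(1)] by blast
  \<comment> \<open>The finite generating set is listed and padded with 1 to a sequence.\<close>
  define s where "s i = (if i < length xs then xs ! i else \<one>\<^bsub>H\<^esub>)" for i
  have Ts: "T \<subseteq> range s" using xs by (force simp: s_def in_set_conv_nth)
  have "range s \<subseteq> insert \<one>\<^bsub>H\<^esub> T" using xs by (auto simp: s_def)
  then have s: "range s \<subseteq> carrier H" and fin: "finite (range s)"
    using T(1,2) by (auto intro: finite_subset)
  have gen: "generate H (range s) = carrier H"
    using H.mono_generate[OF Ts] H.generate_incl[OF s] T(3) by blast
  obtain D where D: "D \<subseteq> carrier H" "infinite D"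
    and sparse: "\<And>r. finite {y\<in>D. \<exists>z\<in>D. z \<noteq> y \<and> z \<otimes>\<^bsub>H\<^esub> inv\<^bsub>H\<^esub> y \<in> cball H s r}"
    using exists_sparse_set[OF H s fin assms(5)] by blast
  let ?g = "gens B H a b s"
  define S where "S = generate (wreath B H) (range (?g D))"
  define G where "G = (wreath B H)\<lparr>carrier := S\<rparr>"
  have g: "range (?g E) \<subseteq> carrier (wreath B H)" for E by (rule gens_closed[OF B H s a b])
  have S: "subgroup S (wreath B H)" unfolding S_def by (rule W.generate_is_subgroup[OF g])
  have G: "group G" unfolding G_def by (rule W.subgroup_imp_group[OF S])
  have gD: "range (?g D) \<subseteq> S" unfolding S_def by (blast intro: generate.incl)
  have finD: "finite (range (?g D))" by (rule finite_range_gens[OF B H s a b fin])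
  have genG: "generate G (range (?g D)) = carrier G"
    using W.generate_consistent[OF gD S] by (simp add: G_def S_def)
  have "deformable G (?g D)"
    unfolding deformable_def
  proof
    fix r
    \<comment> \<open>Points near 1 or near another point of \<open>D\<close> are finite in number,
      so two good points remain: \<open>y\<close> is removed and \<open>y'\<close> stays as the
      witness.\<close>
    define bad where "bad = cball H s (2 * r) \<union>
      {y\<in>D. \<exists>z\<in>D. z \<noteq> y \<and> z \<otimes>\<^bsub>H\<^esub> inv\<^bsub>H\<^esub> y \<in> cball H s (2 * r)}"
    have "finite bad" unfolding bad_def using finite_cball[OF fin] sparse by blast
    then have inf: "infinite (D - bad)" using D(2) by (rule Diff_infinite_finite)
    then obtain y where y: "y \<in> D" "y \<notin> bad" by (metis DiffD1 DiffD2 finite.emptyI ex_in_conv)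
    obtain y' where y': "y' \<in> D" "y' \<notin> bad" "y' \<noteq> y"
      using infinite_remove[OF inf, of y] by (metis DiffD1 DiffD2 finite.emptyI ex_in_conv singletonI)
    let ?g' = "?g (D - {y})"
    have gen': "generate (wreath B H) (range ?g') = S"
      unfolding S_def by (rule generate_gens_remove_point[OF B H s a b gen y(1) D(1)])
    have g'S: "range ?g' \<subseteq> S" unfolding gen'[symmetric] by (blast intro: generate.incl)
    \<comment> \<open>Words have the same value in the subgroup and in the wreath product, so
      agreement can be checked in the latter.\<close>
    have "(\<lambda>u. u) \<in> hom G (wreath B H)"
      using subgroup.subset[OF S] by (auto simp: hom_def G_def)
    from pair_ball_hom[OF G group_wreath[OF B H] this, of "?g D" ?g'] gD g'S
    have "pair_ball G (?g D) ?g' k = pair_ball (wreath B H) (?g D) ?g' k" for k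
      by (simp add: G_def map_prod.identity[unfolded id_def])
    then have agree: "agree_upto G k (?g D) ?g' \<longleftrightarrow> agree_upto (wreath B H) k (?g D) ?g'" for k
      by (simp add: agree_upto_def G_def)
    have "agree_upto G r (?g D) ?g'"
      unfolding agree
      by (rule agree_upto_remove_isolated[OF B H s a b D(1), where y' = y'])
        (use y y' in \<open>auto simp: bad_def\<close>)
    moreover have "\<exists>k. \<not> agree_upto G k (?g D) ?g'"
      unfolding agree by (rule disagree_remove_point[OF B H s a b gen y(1) D(1) ab])
    moreover have "generate G (range ?g') = carrier G"
      using W.generate_consistent[OF g'S S] gen' by (simp add: G_def)
    ultimately show "\<exists>b. range b \<subseteq> carrier G \<and> generate G (range b) = carrier G
       \<and> agree_upto G r (?g D) b \<and> (\<exists>k. \<not> agree_upto G k (?g D) b)"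
      using g'S by (intro exI[of _ ?g']) (simp add: G_def)
  qed
  moreover have "range (?g D) \<subseteq> carrier G" using gD by (simp add: G_def)
  ultimately have "condensed G"
    using condensed_if_deformable[OF G _ finD genG] by blast
  moreover have "fin_gen G"
    unfolding fin_gen_def using finD gD genG by (intro exI[of _ "range (?g D)"]) (simp add: G_def)
  ultimately show ?thesis using S unfolding G_def by blast
qed

end
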